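(* Let $\mathcal{C}$ be a hereditary class of graphs and $b : \mathbb{N} \rightarrow \mathbb{N}$ be a poly-logarithmic function. Then the following are equivalent: (i) There exist a poly-logarithmic function $a$ and a quasi-polynomial function $f$ such that for every $n$-vertex graph $G \in \mathcal{C}$, $G$ has a $(b(n), a(n))$-container family $\mathcal{F}$ with $|\mathcal{F}| \leq f(n)$. (ii) There exists a positive integer $k$ such that $\overline{kK_k} \notin \mathcal{C}$.
   Context: Graphs are finite and simple; $\mathbb{N}$ denotes the positive integers; logarithms are base $2$. A class of graphs is hereditary if it is closed under taking induced subgraphs. A function $g:\mathbb{N}\to\mathbb{N}$ is poly-logarithmic if there exist positive integers $c,d$ such that $g(n)\leq c\log^d n$ for every $n\geq 3$, and quasi-polynomial if there exist positive integers $c,d$ such that $g(n)\leq c\, n^{\log^d n}$ for every $n$. Here $\log^d n = (\log n)^d$. For $X\subseteq V(G)$, $\alpha(X)$ is the largest size of an independent set in $G[X]$. For positive integers $a,b$, a family $\mathcal{F}$ of vertex subsets of $G$ is a $(b,a)$-container family of $G$ if $\alpha(F)\leq a$ for every $F\in\mathcal{F}$ and for every $H\subseteq V(G)$ with $\alpha(H)\leq b$ there is some $F\in\mathcal{F}$ with $H\subseteq F$. $kK_k$ is the disjoint union of $k$ pairwise anti-complete copies of the complete graph $K_k$, and $\overline{kK_k}$ is its complement (the complete $k$-partite graph with all parts of size $k$). *)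

theory Defs
  imports Complex_Main "Graph_Theory.Graph_Theory"
begin

text \<open>
  A finite simple graph is a \<^const>\<open>pair_graph\<close>: finitely many vertices and a symmetric,
  irreflexive set of arcs, an edge \<open>{u, v}\<close> being the two arcs \<open>(u, v)\<close> and \<open>(v, u)\<close>.
  Since every finite graph is isomorphic to one whose vertices are natural numbers, a class of
  graphs is given by its members on such vertex sets; as a class of graphs it is closed under
  isomorphism.
\<close>

definition graph_class :: "nat pair_pre_digraph set \<Rightarrow> bool" where
  "graph_class C \<longleftrightarrow>
     (\<forall>G\<in>C. pair_graph G) \<and>
     (\<forall>G\<in>C. \<forall>H. digraph_iso (with_proj G) (with_proj H) \<longrightarrow> H \<in> C)"

definition hereditary :: "nat pair_pre_digraph set \<Rightarrow> bool" where
  "hereditary C \<longleftrightarrow>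
     graph_class C \<and>
     (\<forall>G\<in>C. \<forall>H. induced_subgraph (with_proj H) (with_proj G) \<longrightarrow> H \<in> C)"

text \<open>Membership of a graph on an arbitrary vertex type in a class of graphs.\<close>

definition in_graph_class :: "'a pair_pre_digraph \<Rightarrow> nat pair_pre_digraph set \<Rightarrow> bool" where
  "in_graph_class G C \<longleftrightarrow> (\<exists>H\<in>C. digraph_iso (with_proj G) (with_proj H))"

text \<open>
  A function from the positive integers to the positive integers is a function on \<^typ>\<open>nat\<close>
  whose value at \<open>0\<close> is ignored and whose values elsewhere are positive.
\<close>

definition poly_logarithmic :: "(nat \<Rightarrow> nat) \<Rightarrow> bool" where
  "poly_logarithmic g \<longleftrightarrow>
     (\<forall>n\<ge>1. g n \<ge> 1) \<and>
     (\<exists>c d :: nat. c \<ge> 1 \<and> d \<ge> 1 \<and>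
        (\<forall>n\<ge>3. real (g n) \<le> real c * log 2 (real n) ^ d))"

definition quasi_polynomial :: "(nat \<Rightarrow> nat) \<Rightarrow> bool" where
  "quasi_polynomial g \<longleftrightarrow>
     (\<forall>n\<ge>1. g n \<ge> 1) \<and>
     (\<exists>c d :: nat. c \<ge> 1 \<and> d \<ge> 1 \<and>
        (\<forall>n\<ge>1. real (g n) \<le> real c * real n powr (log 2 (real n) ^ d)))"

definition independent_set :: "'a pair_pre_digraph \<Rightarrow> 'a set \<Rightarrow> bool" where
  "independent_set G S \<longleftrightarrow>
     S \<subseteq> pverts G \<and> (\<forall>u\<in>S. \<forall>v\<in>S. (u, v) \<notin> parcs G)"

text \<open>
  The independent sets of \<open>G[X]\<close> are the independent sets of \<open>G\<close> contained in \<open>X\<close>.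
  \<open>X\<close> is meant to be a set of vertices of a finite graph, so that the maximum exists.
\<close>

definition indep_number :: "'a pair_pre_digraph \<Rightarrow> 'a set \<Rightarrow> nat" where
  "indep_number G X = Max {card S | S. S \<subseteq> X \<and> independent_set G S}"

definition container_family ::
  "nat \<Rightarrow> nat \<Rightarrow> 'a pair_pre_digraph \<Rightarrow> 'a set set \<Rightarrow> bool" where
  "container_family b a G \<F> \<longleftrightarrow>
     (\<forall>F\<in>\<F>. F \<subseteq> pverts G) \<and>
     (\<forall>F\<in>\<F>. indep_number G F \<le> a) \<and>
     (\<forall>H. H \<subseteq> pverts G \<and> indep_number G H \<le> b \<longrightarrow> (\<exists>F\<in>\<F>. H \<subseteq> F))"

definition complete_graph :: "nat \<Rightarrow> nat pair_pre_digraph" where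
  "complete_graph n =
     \<lparr> pverts = {..<n}, parcs = {(x, y). x \<in> {..<n} \<and> y \<in> {..<n} \<and> x \<noteq> y} \<rparr>"

definition disjoint_copies :: "nat \<Rightarrow> 'a pair_pre_digraph \<Rightarrow> (nat \<times> 'a) pair_pre_digraph" where
  "disjoint_copies k G =
     \<lparr> pverts = {..<k} \<times> pverts G,
       parcs = {((i, x), (j, y)). i \<in> {..<k} \<and> i = j \<and> (x, y) \<in> parcs G} \<rparr>"

definition complement_graph :: "'a pair_pre_digraph \<Rightarrow> 'a pair_pre_digraph" where
  "complement_graph G =
     \<lparr> pverts = pverts G,
       parcs = {(x, y). x \<in> pverts G \<and> y \<in> pverts G \<and> x \<noteq> y \<and> (x, y) \<notin> parcs G} \<rparr>"

end

theory Submission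
  imports Defs
begin

text \<open>
  From containers to an excluded complete multipartite graph: a container of \<open>K_{k,...,k}\<close> with
  independence number \<open>a\<close> contains at most \<open>a ^ k\<close> of the \<open>k ^ k\<close> transversals, all of which are
  cliques. So at least \<open>(k / a) ^ k\<close> containers are needed, which is more than quasi-polynomial in
  the number \<open>k ^ 2\<close> of vertices.

  Conversely, induct on the number \<open>j\<close> of parts of an excluded complete multipartite graph with parts
  of size \<open>k\<close>. Let \<open>H\<close> have independence number at most \<open>b\<close>, put \<open>m = b k + 1\<close>, and call a
  vertex heavy if it has at least \<open>k\<close> neighbours in at least a \<open>1 / (2 b)\<close> fraction of the
  independent \<open>m\<close>-sets. By greedy covering, poly-logarithmically many independent \<open>k\<close>-sets suffice
  for every heavy vertex to be complete to one of them. The common neighbourhood of an independent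
  \<open>k\<close>-set excludes \<open>j - 1\<close> parts, so the induction hypothesis handles this part of \<open>H\<close>. The rest of
  \<open>H\<close> is dominated by at most \<open>b\<close> of its own vertices, which can be guessed. They are not heavy, and
  an independent \<open>m\<close>-set inside their closed neighbourhood has at least \<open>k\<close> neighbours of one of
  them, so passing to that neighbourhood halves the number of independent \<open>m\<close>-sets. After about
  \<open>m log n\<close> rounds none are left.
\<close>

subsection \<open>Covering subgraphs of small independence number\<close>

text \<open>The container property relative to a vertex set, so that the recursion can split and
  restrict \<open>X\<close>. Finiteness is part of it because \<open>card\<close> of an infinite
  family is 0.\<close>

definition coverable :: "'a pair_pre_digraph \<Rightarrow> nat \<Rightarrow> 'a set \<Rightarrow> nat \<Rightarrow> nat \<Rightarrow> bool" where
  "coverable G b X a c \<longleftrightarrow>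
     (\<exists>\<F>. finite \<F> \<and> card \<F> \<le> c \<and> (\<forall>F\<in>\<F>. F \<subseteq> X \<and> indep_number G F \<le> a) \<and>
        (\<forall>H\<subseteq>X. indep_number G H \<le> b \<longrightarrow> (\<exists>F\<in>\<F>. H \<subseteq> F)))"

text \<open>An induced complete \<open>j\<close>-partite subgraph with all parts of size
  \<open>k\<close>. In a loopless graph distinct parts are disjoint, since a common vertex would
  carry a loop.\<close>

definition multipartite :: "'a pair_pre_digraph \<Rightarrow> 'a set \<Rightarrow> nat \<Rightarrow> nat \<Rightarrow> bool" where
  "multipartite G X j k \<longleftrightarrow>
     (\<exists>f :: nat \<Rightarrow> 'a set. (\<forall>i<j. f i \<subseteq> X \<and> independent_set G (f i) \<and> card (f i) = k) \<and>
        (\<forall>i<j. \<forall>i'<j. i \<noteq> i' \<longrightarrow> f i \<times> f i' \<subseteq> parcs G))"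

definition common_nbrs :: "'a pair_pre_digraph \<Rightarrow> 'a set \<Rightarrow> 'a set" where
  "common_nbrs G I = {v \<in> pverts G. I \<subseteq> parcs G `` {v}}"

definition indep_sets :: "'a pair_pre_digraph \<Rightarrow> 'a set \<Rightarrow> nat \<Rightarrow> 'a set set" where
  "indep_sets G X m = {M. M \<subseteq> X \<and> independent_set G M \<and> card M = m}"

lemma indep_number_le_iff:
  assumes "finite (pverts G)"
  shows "indep_number G X \<le> a \<longleftrightarrow> (\<forall>S\<subseteq>X. independent_set G S \<longrightarrow> card S \<le> a)"
proof -
  let ?A = "{card S | S. S \<subseteq> X \<and> independent_set G S}"
  have "?A \<subseteq> card ` Pow (pverts G)"
    by (auto simp: independent_set_def)
  hence "finite ?A"
    using assms by (meson finite_Pow_iff finite_imageI finite_subset)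
  moreover have "card ({} :: 'a set) \<in> ?A"
    unfolding independent_set_def by blast
  ultimately show ?thesis
    unfolding indep_number_def by (subst Max_le_iff) auto
qed

lemma independent_set_subset:
  "independent_set G S \<Longrightarrow> T \<subseteq> S \<Longrightarrow> independent_set G T"
  unfolding independent_set_def by blast

lemma independent_set_finite:
  "finite (pverts G) \<Longrightarrow> independent_set G S \<Longrightarrow> finite S"
  unfolding independent_set_def using finite_subset by blast

lemma indep_number_mono:
  assumes "finite (pverts G)" "X \<subseteq> Y"
  shows "indep_number G X \<le> indep_number G Y"
  using assms indep_number_le_iff[of G Y "indep_number G Y"] 
  by (auto simp: indep_number_le_iff)

lemma indep_number_Un:
  assumes "finite (pverts G)"
  shows "indep_number G (X \<union> Y) \<le> indep_number G X + indep_number G Y"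
proof (subst indep_number_le_iff[OF assms], intro allI impI)
  fix S assume S: "S \<subseteq> X \<union> Y" "independent_set G S"
  have "card (S \<inter> Z) \<le> indep_number G Z" for Z
    using indep_number_le_iff[OF assms, of Z "indep_number G Z"]
      independent_set_subset[OF S(2), of "S \<inter> Z"] by simp
  moreover have "card S \<le> card (S \<inter> X) + card (S \<inter> Y)"
    using card_Un_le[of "S \<inter> X" "S \<inter> Y"] S(1) by (simp add: Int_Un_distrib[symmetric] Int_absorb2)
  ultimately show "card S \<le> indep_number G X + indep_number G Y"
    by (meson add_mono order_trans)
qed

lemma coverable_mono:
  assumes "coverable G b X a c" "a \<le> a'" "c \<le> c'"
  shows "coverable G b X a' c'"
  using assms unfolding coverable_def by (meson order_trans)

lemma coverable_subset:
  assumes "finite (pverts G)" "coverable G b X a c" "Y \<subseteq> X"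
  shows "coverable G b Y a c"
proof -
  obtain \<F> where F: "finite \<F>" "card \<F> \<le> c" "\<And>F. F \<in> \<F> \<Longrightarrow> F \<subseteq> X \<and> indep_number G F \<le> a"
    "\<And>H. H \<subseteq> X \<Longrightarrow> indep_number G H \<le> b \<Longrightarrow> \<exists>F\<in>\<F>. H \<subseteq> F"
    using assms unfolding coverable_def by metis
  let ?F = "(\<lambda>F. F \<inter> Y) ` \<F>"
  have "finite ?F" "card ?F \<le> c"
    using F(1) order_trans[OF card_image_le[OF F(1)] F(2)] by auto
  moreover have "\<forall>F\<in>?F. F \<subseteq> Y \<and> indep_number G F \<le> a"
    using F(3) indep_number_mono[OF assms(1) Int_lower1] by (auto intro: order_trans)
  moreover have "\<forall>H\<subseteq>Y. indep_number G H \<le> b \<longrightarrow> (\<exists>F\<in>?F. H \<subseteq> F)"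
    using F(4) assms(3) by (meson Int_greatest image_eqI order_trans)
  ultimately show ?thesis unfolding coverable_def by blast
qed

lemma coverable_trivial:
  assumes "indep_number G X \<le> a" "c \<ge> 1"
  shows "coverable G b X a c"
  unfolding coverable_def using assms by (intro exI[of _ "{X}"]) auto

text \<open>The traces of \<open>H\<close> on \<open>X\<close> and on \<open>Y\<close> each lie in a
  container, so unions of pairs of containers serve. Independence numbers add and counts
  multiply.\<close>

lemma coverable_Un:
  assumes "finite (pverts G)" "coverable G b X a c" "coverable G b Y a' c'"
  shows "coverable G b (X \<union> Y) (a + a') (c * c')"
proof -
  obtain \<F> where F: "finite \<F>" "card \<F> \<le> c" "\<And>F. F \<in> \<F> \<Longrightarrow> F \<subseteq> X \<and> indep_number G F \<le> a"
    "\<And>H. H \<subseteq> X \<Longrightarrow> indep_number G H \<le> b \<Longrightarrow> \<exists>F\<in>\<F>. H \<subseteq> F"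
    using assms(2) unfolding coverable_def by metis
  obtain \<F>' where F': "finite \<F>'" "card \<F>' \<le> c'"
    "\<And>F. F \<in> \<F>' \<Longrightarrow> F \<subseteq> Y \<and> indep_number G F \<le> a'"
    "\<And>H. H \<subseteq> Y \<Longrightarrow> indep_number G H \<le> b \<Longrightarrow> \<exists>F\<in>\<F>'. H \<subseteq> F"
    using assms(3) unfolding coverable_def by metis
  let ?F = "(\<lambda>(A, B). A \<union> B) ` (\<F> \<times> \<F>')"
  have "card ?F \<le> card (\<F> \<times> \<F>')"
    using F(1) F'(1) by (intro card_image_le) auto
  also have "\<dots> \<le> c * c'"
    using F(2) F'(2) by (simp add: card_cartesian_product mult_le_mono)
  finally have "card ?F \<le> c * c'" .
  moreover have "finite ?F" using F(1) F'(1) by simp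
  moreover have "\<forall>F\<in>?F. F \<subseteq> X \<union> Y \<and> indep_number G F \<le> a + a'"
  proof
    fix F assume "F \<in> ?F"
    then obtain A B where AB: "A \<in> \<F>" "B \<in> \<F>'" "F = A \<union> B" by auto
    show "F \<subseteq> X \<union> Y \<and> indep_number G F \<le> a + a'"
      using F(3)[OF AB(1)] F'(3)[OF AB(2)] indep_number_Un[OF assms(1), of A B] AB(3) by auto
  qed
  moreover have "\<forall>H\<subseteq>X \<union> Y. indep_number G H \<le> b \<longrightarrow> (\<exists>F\<in>?F. H \<subseteq> F)"
  proof (intro allI impI)
    fix H assume H: "H \<subseteq> X \<union> Y" "indep_number G H \<le> b"
    have "indep_number G (H \<inter> Z) \<le> b" for Z
      using indep_number_mono[OF assms(1), of "H \<inter> Z" H] H(2) by simp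
    then obtain A B where "A \<in> \<F>" "B \<in> \<F>'" "H \<inter> X \<subseteq> A" "H \<inter> Y \<subseteq> B"
      using F(4)[of "H \<inter> X"] F'(4)[of "H \<inter> Y"] by auto
    moreover have "H \<subseteq> A \<union> B" using calculation H(1) by auto
    ultimately show "\<exists>F\<in>?F. H \<subseteq> F" by (auto intro!: bexI[of _ "(A, B)"])
  qed
  ultimately show ?thesis unfolding coverable_def by blast
qed

lemma coverable_UN:
  assumes "finite (pverts G)" "finite Q" "\<And>p. p \<in> Q \<Longrightarrow> coverable G b (Y p) a c"
  shows "coverable G b (\<Union>p\<in>Q. Y p) (card Q * a) (c ^ card Q)"
  using assms(2,3)
proof (induction Q rule: finite_induct)
  case empty
  have "indep_number G {} \<le> 0"
    by (subst indep_number_le_iff[OF assms(1)]) auto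
  thus ?case using coverable_trivial[of G "{}" 0 1 b] by simp
next
  case (insert p Q)
  have "coverable G b (Y p \<union> (\<Union>p\<in>Q. Y p)) (a + card Q * a) (c * c ^ card Q)"
    using insert by (intro coverable_Un assms(1)) auto
  thus ?case using insert by simp
qed

text \<open>This is the guessing step: when each \<open>H\<close> lies in one of the sets
  \<open>Y S\<close>, their families are pooled. Counts add, while the bound on the independence
  number does not grow, in contrast to \<open>coverable_Un\<close>.\<close>

lemma coverable_branch:
  assumes "finite \<S>" "\<And>S. S \<in> \<S> \<Longrightarrow> coverable G b (Y S) a c" "\<And>S. S \<in> \<S> \<Longrightarrow> Y S \<subseteq> X"
    and "\<And>H. H \<subseteq> X \<Longrightarrow> indep_number G H \<le> b \<Longrightarrow> \<exists>S\<in>\<S>. H \<subseteq> Y S"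
  shows "coverable G b X a (card \<S> * c)"
proof -
  have "\<forall>S\<in>\<S>. \<exists>\<F>. finite \<F> \<and> card \<F> \<le> c \<and> (\<forall>F\<in>\<F>. F \<subseteq> Y S \<and> indep_number G F \<le> a) \<and>
        (\<forall>H\<subseteq>Y S. indep_number G H \<le> b \<longrightarrow> (\<exists>F\<in>\<F>. H \<subseteq> F))"
    using assms(2) unfolding coverable_def by blast
  then obtain \<F> where F: "\<And>S. S \<in> \<S> \<Longrightarrow> finite (\<F> S) \<and> card (\<F> S) \<le> c"
    "\<And>S F. S \<in> \<S> \<Longrightarrow> F \<in> \<F> S \<Longrightarrow> F \<subseteq> Y S \<and> indep_number G F \<le> a"
    "\<And>S H. S \<in> \<S> \<Longrightarrow> H \<subseteq> Y S \<Longrightarrow> indep_number G H \<le> b \<Longrightarrow> \<exists>F\<in>\<F> S. H \<subseteq> F"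
    by metis
  have "card (\<Union>S\<in>\<S>. \<F> S) \<le> (\<Sum>S\<in>\<S>. card (\<F> S))"
    by (rule card_UN_le[OF assms(1)])
  also have "\<dots> \<le> card \<S> * c"
    using F(1) sum_bounded_above[of \<S> "\<lambda>S. card (\<F> S)" c] by auto
  finally have "card (\<Union>S\<in>\<S>. \<F> S) \<le> card \<S> * c" .
  moreover have "finite (\<Union>S\<in>\<S>. \<F> S)" using F(1) assms(1) by auto
  moreover have "\<forall>F\<in>(\<Union>S\<in>\<S>. \<F> S). F \<subseteq> X \<and> indep_number G F \<le> a"
    using F(2) assms(3) by blast
  moreover have "\<forall>H\<subseteq>X. indep_number G H \<le> b \<longrightarrow> (\<exists>F\<in>(\<Union>S\<in>\<S>. \<F> S). H \<subseteq> F)"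
    using F(3) assms(4) by (meson UN_I)
  ultimately show ?thesis unfolding coverable_def by blast
qed

text \<open>The set \<open>I\<close> itself becomes the new part. Read contrapositively, it makes
  the induction hypothesis for \<open>j\<close> parts available on the common neighbourhood of
  \<open>I\<close>.\<close>

lemma multipartite_Suc:
  assumes "sym (parcs G)" "I \<in> indep_sets G X k" "multipartite G (X \<inter> common_nbrs G I) j k"
  shows "multipartite G X (Suc j) k"
proof -
  obtain f :: "nat \<Rightarrow> 'a set" where
    f: "\<And>i. i < j \<Longrightarrow> f i \<subseteq> X \<inter> common_nbrs G I \<and> independent_set G (f i) \<and> card (f i) = k"
      "\<And>i i'. i < j \<Longrightarrow> i' < j \<Longrightarrow> i \<noteq> i' \<Longrightarrow> f i \<times> f i' \<subseteq> parcs G"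
    using assms(3) unfolding multipartite_def by metis
  have new: "f i \<times> I \<subseteq> parcs G" "I \<times> f i \<subseteq> parcs G" if "i < j" for i
    using f(1)[OF that] assms(1) unfolding common_nbrs_def by (auto dest: symD)
  show ?thesis
    unfolding multipartite_def
  proof (intro exI[of _ "f(j := I)"] conjI allI impI)
    fix i assume "i < Suc j"
    thus "(f(j := I)) i \<subseteq> X" "independent_set G ((f(j := I)) i)" "card ((f(j := I)) i) = k"
      using f(1)[of i] assms(2) by (auto simp: indep_sets_def less_Suc_eq)
  next
    fix i i' assume "i < Suc j" "i' < Suc j" "i \<noteq> i'"
    thus "(f(j := I)) i \<times> (f(j := I)) i' \<subseteq> parcs G"
      using f(2)[of i i'] new[of i] new[of i'] by (cases "i = j"; cases "i' = j") simp_all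
  qed
qed

text \<open>An inclusion-maximal independent subset of \<open>H\<close> dominates \<open>H\<close>.
  Its size is at most the independence number of \<open>H\<close>, so it is small enough to be
  guessed.\<close>

lemma dominating_independent_subset:
  assumes "pair_graph G" "H \<subseteq> pverts G"
  obtains S where "S \<subseteq> H" "independent_set G S" "H \<subseteq> S \<union> parcs G `` S"
proof -
  interpret pair_graph G by fact
  let ?A = "{S. S \<subseteq> H \<and> independent_set G S}"
  have "finite ?A"
    using finite_subset[OF assms(2) pair_finite_verts] by simp
  moreover have "?A \<noteq> {}" by (auto simp: independent_set_def intro!: exI[of _ "{}"])
  ultimately obtain S where S: "S \<in> ?A" "\<And>T. T \<in> ?A \<Longrightarrow> S \<subseteq> T \<Longrightarrow> S = T"
    using finite_has_maximal[of ?A] by metis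
  have "v \<in> S \<union> parcs G `` S" if "v \<in> H" for v
  proof (rule ccontr)
    assume v: "v \<notin> S \<union> parcs G `` S"
    have sym: "sym (parcs G)" using pair_sym_arcs by (simp add: symmetric_def)
    have "(v, v) \<notin> parcs G" using pair_no_loops[of "(v, v)"] by auto
    hence "insert v S \<in> ?A"
      using v S(1) that assms(2) symD[OF sym] unfolding independent_set_def by blast
    thus False using S(2)[of "insert v S"] v by auto
  qed
  thus thesis using that[of S] S(1) by blast
qed

section \<open>Greedy covering and counting of small subsets\<close>

text \<open>By averaging, some \<open>p\<close> covers at least a \<open>1 / q\<close> fraction of
  the vertices still uncovered, so each choice shrinks their number by the factor
  \<open>(q - 1) / q\<close>. Denominators are cleared to stay within the naturals.\<close>

lemma greedy_cover:
  fixes R :: "'p \<Rightarrow> 'v \<Rightarrow> bool"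
  assumes "finite W" "finite P" "P \<noteq> {}"
    and "\<And>v. v \<in> W \<Longrightarrow> card P \<le> q * card {p\<in>P. R p v}"
  shows "\<exists>Q\<subseteq>P. card Q \<le> t \<and> card {v\<in>W. \<forall>p\<in>Q. \<not> R p v} * q ^ t \<le> card W * (q - 1) ^ t"
proof (induction t)
  case 0
  show ?case by (intro exI[of _ "{}"]) auto
next
  case (Suc t)
  then obtain Q where Q: "Q \<subseteq> P" "card Q \<le> t"
    "card {v\<in>W. \<forall>p\<in>Q. \<not> R p v} * q ^ t \<le> card W * (q - 1) ^ t" by blast
  define U where "U = {v\<in>W. \<forall>p\<in>Q. \<not> R p v}"
  have "finite U" using assms(1) by (simp add: U_def)
  have "\<exists>p\<in>P. card U \<le> q * card {v\<in>U. R p v}"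
  proof (rule ccontr)
    assume "\<not> ?thesis"
    hence "(\<Sum>p\<in>P. q * card {v\<in>U. R p v}) < (\<Sum>p\<in>P. card U)"
      using assms(2,3) by (intro sum_strict_mono) auto
    also have "\<dots> = (\<Sum>v\<in>U. card P)" by simp
    also have "\<dots> \<le> (\<Sum>v\<in>U. q * card {p\<in>P. R p v})"
      using assms(4) by (intro sum_mono) (auto simp: U_def)
    \<comment> \<open>Both sums count the related pairs between \<open>P\<close> and
      \<open>U\<close>.\<close>
    also have "\<dots> = (\<Sum>p\<in>P. q * card {v\<in>U. R p v})"
      using sum_multicount_gen[OF \<open>finite P\<close> \<open>finite U\<close>, of R "\<lambda>v. card {p\<in>P. R p v}"]
      by (simp add: sum_distrib_left[symmetric])
    finally show False by simp
  qed
  then obtain p where p: "p \<in> P" "card U \<le> q * card {v\<in>U. R p v}" by blast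
  define U' where "U' = {v\<in>W. \<forall>p\<in>insert p Q. \<not> R p v}"
  have "U = {v\<in>U. R p v} \<union> U'" "{v\<in>U. R p v} \<inter> U' = {}" "finite U'"
    using assms(1) by (auto simp: U_def U'_def)
  hence "card U = card {v\<in>U. R p v} + card U'"
    using card_Un_disjoint[of "{v\<in>U. R p v}" U'] \<open>finite U\<close> by simp
  \<comment> \<open>For \<open>q = 0\<close> the truncated difference \<open>q - 1\<close> is 0 and
    both sides vanish.\<close>
  hence "card U' * q \<le> card U * (q - 1)"
    using p(2) by (cases q) (simp_all add: algebra_simps)
  hence "card U' * q * q ^ t \<le> card U * q ^ t * (q - 1)"
    using mult_le_mono1[of "card U' * q" "card U * (q - 1)" "q ^ t"] by (simp only: mult.assoc mult.commute[of "q - 1"])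
  also have "\<dots> \<le> card W * (q - 1) ^ t * (q - 1)"
    using Q(3) by (intro mult_le_mono1) (simp add: U_def)
  finally have "card U' * q ^ Suc t \<le> card W * (q - 1) ^ Suc t"
    by (simp add: algebra_simps)
  moreover have "card (insert p Q) \<le> Suc t"
    using Q(2) finite_subset[OF Q(1) assms(2)] by (simp add: card_insert_if)
  ultimately show ?case
    using Q(1) p(1) unfolding U'_def by (intro exI[of _ "insert p Q"]) auto
qed

text \<open>These are the two leading terms of the binomial expansion of
  \<open>(p + 1) ^ (n + 1)\<close>.\<close>

lemma Suc_power_ge: "p ^ Suc n + Suc n * p ^ n \<le> Suc p ^ Suc n"
proof (induction n)
  case (Suc n)
  have "p ^ Suc (Suc n) + Suc (Suc n) * p ^ Suc n \<le> Suc p * (p ^ Suc n + Suc n * p ^ n)"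
    by (simp add: algebra_simps)
  also have "\<dots> \<le> Suc p ^ Suc (Suc n)"
    using Suc mult_le_mono2 by (metis power_Suc)
  finally show ?case .
qed simp

text \<open>This is \<open>(1 - 1 / q) ^ q \<le> 1 / 2\<close>: every \<open>q\<close> greedy
  choices halve the uncovered set.\<close>

lemma power_pred_half:
  assumes "q \<ge> 1"
  shows "2 * (q - 1) ^ q \<le> (q :: nat) ^ q"
proof -
  obtain p where p: "q = Suc p" using assms by (cases q) auto
  have "2 * p ^ Suc p \<le> p ^ Suc p + Suc p * p ^ p" by simp
  also have "\<dots> \<le> Suc p ^ Suc p" by (rule Suc_power_ge)
  finally show ?thesis by (simp add: p)
qed

text \<open>With \<open>q * L\<close> greedy choices the uncovered set is halved \<open>L\<close>
  times. It started below \<open>2 ^ L\<close>, so fewer than one vertex remains.\<close>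

lemma log_cover:
  fixes R :: "'p \<Rightarrow> 'v \<Rightarrow> bool"
  assumes "finite W" "finite P" "P \<noteq> {}" "q \<ge> 1" "card W < 2 ^ L"
    and "\<And>v. v \<in> W \<Longrightarrow> card P \<le> q * card {p\<in>P. R p v}"
  shows "\<exists>Q\<subseteq>P. card Q \<le> q * L \<and> (\<forall>v\<in>W. \<exists>p\<in>Q. R p v)"
proof -
  obtain Q where Q: "Q \<subseteq> P" "card Q \<le> q * L"
    "card {v\<in>W. \<forall>p\<in>Q. \<not> R p v} * q ^ (q * L) \<le> card W * (q - 1) ^ (q * L)"
    using greedy_cover[OF assms(1-3), of q R "q * L"] assms(6) by blast
  let ?U = "{v\<in>W. \<forall>p\<in>Q. \<not> R p v}"
  have "2 ^ L * (q - 1) ^ (q * L) = (2 * (q - 1) ^ q) ^ L"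
    by (simp add: power_mult power_mult_distrib)
  also have "\<dots> \<le> q ^ (q * L)"
    using power_mono[OF power_pred_half[OF assms(4)]] by (simp add: power_mult)
  finally have half: "2 ^ L * (q - 1) ^ (q * L) \<le> q ^ (q * L)" .
  have "card ?U = 0"
  proof (rule ccontr)
    assume "card ?U \<noteq> 0"
    hence "2 ^ L * q ^ (q * L) \<le> 2 ^ L * (card ?U * q ^ (q * L))" by simp
    also have "\<dots> \<le> 2 ^ L * (card W * (q - 1) ^ (q * L))"
      using Q(3) mult_le_mono2 by blast
    also have "\<dots> \<le> card W * q ^ (q * L)"
      using half by (metis mult.left_commute mult_le_mono2)
    finally show False using assms(4,5) by simp
  qed
  hence "?U = {}" using assms(1) by simp
  thus ?thesis using Q(1,2) by blast
qed

text \<open>Each such subset is the range of a list of length at most \<open>b\<close>. The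
  resulting sum of powers is bounded termwise by the binomial expansion of
  \<open>(card V + 1) ^ b\<close>.\<close>

lemma card_subsets_le:
  assumes "finite V"
  shows "finite {S. S \<subseteq> V \<and> card S \<le> b}" "card {S. S \<subseteq> V \<and> card S \<le> b} \<le> (card V + 1) ^ b"
proof -
  let ?L = "{xs. set xs \<subseteq> V \<and> length xs \<le> b}"
  have sub: "{S. S \<subseteq> V \<and> card S \<le> b} \<subseteq> set ` ?L"
  proof
    fix S assume S: "S \<in> {S. S \<subseteq> V \<and> card S \<le> b}"
    hence "finite S" using assms finite_subset by auto
    then obtain xs where "set xs = S" "distinct xs" using finite_distinct_list by blast
    thus "S \<in> set ` ?L" using S distinct_card[of xs] by auto
  qed
  have fin: "finite ?L" using assms finite_lists_length_le by blast
  show "finite {S. S \<subseteq> V \<and> card S \<le> b}" using assms by simp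
  have "card {S. S \<subseteq> V \<and> card S \<le> b} \<le> card ?L"
    using sub fin by (metis (no_types, lifting) card_image_le card_mono finite_imageI order_trans)
  also have "\<dots> = (\<Sum>i\<le>b. card V ^ i)" using assms by (rule card_lists_length_le)
  also have "\<dots> \<le> (\<Sum>i\<le>b. (b choose i) * card V ^ i)"
    by (intro sum_mono) (simp add: Suc_leI)
  also have "\<dots> = (card V + 1) ^ b" using binomial[of "card V" 1 b] by simp
  finally show "card {S. S \<subseteq> V \<and> card S \<le> b} \<le> (card V + 1) ^ b" .
qed

subsection \<open>Heavy vertices and the halving step\<close>

lemma indep_sets_finite:
  assumes "finite (pverts G)"
  shows "finite (indep_sets G X m)"
  using assms by (auto simp: indep_sets_def independent_set_def intro: finite_subset[of _ "Pow (pverts G)"])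

text \<open>Pigeonhole, which explains the size \<open>b * k + 1\<close>: if every \<open>s\<close>
  had fewer than \<open>k\<close> neighbours in \<open>M\<close>, then every closed neighbourhood
  would meet \<open>M\<close> in at most \<open>k\<close> vertices, and \<open>b\<close> of them
  could not cover \<open>M\<close>.\<close>

lemma dense_vertex_exists:
  assumes "finite S" "card S \<le> b" "M \<subseteq> S \<union> parcs G `` S" "independent_set G M" "card M = b * k + 1"
    and "finite M"
  shows "\<exists>s\<in>S. k \<le> card (M \<inter> parcs G `` {s})"
proof (rule ccontr)
  assume "\<not> ?thesis"
  hence *: "card (M \<inter> parcs G `` {s}) < k" if "s \<in> S" for s using that by auto
  \<comment> \<open>If \<open>s\<close> lies in the independent set \<open>M\<close>, the
    intersection is just \<open>s\<close>, and \<open>1 \<le> k\<close> because \<open>k\<close>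
    exceeds a cardinality.\<close>
  have "card (M \<inter> ({s} \<union> parcs G `` {s})) \<le> k" if "s \<in> S" for s
  proof (cases "s \<in> M")
    case True
    hence "M \<inter> parcs G `` {s} = {}" using assms(4) unfolding independent_set_def by auto
    hence "M \<inter> ({s} \<union> parcs G `` {s}) \<subseteq> {s}" by blast
    hence "card (M \<inter> ({s} \<union> parcs G `` {s})) \<le> 1" using card_mono[of "{s}"] by fastforce
    thus ?thesis using *[OF that] by simp
  next
    case False
    hence "M \<inter> ({s} \<union> parcs G `` {s}) = M \<inter> parcs G `` {s}" by blast
    thus ?thesis using *[OF that] by simp
  qed
  hence "(\<Sum>s\<in>S. card (M \<inter> ({s} \<union> parcs G `` {s}))) \<le> card S * k"
    using sum_bounded_above[of S "\<lambda>s. card (M \<inter> ({s} \<union> parcs G `` {s}))" k] by simp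
  also have "\<dots> \<le> b * k" using assms(2) by simp
  finally have "(\<Sum>s\<in>S. card (M \<inter> ({s} \<union> parcs G `` {s}))) \<le> b * k" .
  moreover have "M = (\<Union>s\<in>S. M \<inter> ({s} \<union> parcs G `` {s}))" using assms(3) by blast
  hence "card M \<le> (\<Sum>s\<in>S. card (M \<inter> ({s} \<union> parcs G `` {s})))"
    using card_UN_le[OF assms(1)] by metis
  ultimately show False using assms(5) by simp
qed

text \<open>The density threshold \<open>1 / (2 * b)\<close>, multiplied out. The factor 2 is what
  lets \<open>b\<close> light vertices together account for at most half of \<M>.\<close>

definition heavy :: "'a pair_pre_digraph \<Rightarrow> nat \<Rightarrow> 'a set set \<Rightarrow> nat \<Rightarrow> 'a \<Rightarrow> bool" where
  "heavy G b \<M> k v \<longleftrightarrow> card \<M> \<le> 2 * b * card {M\<in>\<M>. k \<le> card (M \<inter> parcs G `` {v})}"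

text \<open>A union bound: every independent set counted on the left has \<open>k\<close> neighbours
  of some \<open>s\<close> in \<open>S\<close>, and each of the at most \<open>b\<close> light
  vertices accounts for less than a \<open>1 / (2 * b)\<close> fraction.\<close>

lemma light_neighbourhood_halves:
  assumes "finite (pverts G)" "b \<ge> 1" "S \<subseteq> pverts G" "card S \<le> b"
    and "\<And>s. s \<in> S \<Longrightarrow> \<not> heavy G b (indep_sets G X (b * k + 1)) k s"
  shows "2 * card (indep_sets G (X \<inter> (S \<union> parcs G `` S)) (b * k + 1))
           \<le> card (indep_sets G X (b * k + 1))"
proof -
  define \<M> where "\<M> = indep_sets G X (b * k + 1)"
  let ?\<M>' = "indep_sets G (X \<inter> (S \<union> parcs G `` S)) (b * k + 1)"
  let ?d = "\<lambda>s. {M\<in>\<M>. k \<le> card (M \<inter> parcs G `` {s})}"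
  have "finite S" using assms(1,3) finite_subset by blast
  have "finite \<M>" unfolding \<M>_def by (rule indep_sets_finite[OF assms(1)])
  have "?\<M>' \<subseteq> (\<Union>s\<in>S. ?d s)"
  proof
    fix M assume M: "M \<in> ?\<M>'"
    hence "\<exists>s\<in>S. k \<le> card (M \<inter> parcs G `` {s})"
      using independent_set_finite[OF assms(1)]
      by (intro dense_vertex_exists[OF \<open>finite S\<close> assms(4)]) (auto simp: indep_sets_def)
    thus "M \<in> (\<Union>s\<in>S. ?d s)" using M by (auto simp: \<M>_def indep_sets_def)
  qed
  hence "card ?\<M>' \<le> card (\<Union>s\<in>S. ?d s)"
    using \<open>finite S\<close> \<open>finite \<M>\<close> by (intro card_mono) auto
  also have "\<dots> \<le> (\<Sum>s\<in>S. card (?d s))" by (rule card_UN_le[OF \<open>finite S\<close>])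
  finally have "2 * b * card ?\<M>' \<le> (\<Sum>s\<in>S. 2 * b * card (?d s))"
    by (simp add: sum_distrib_left[symmetric])
  also have "\<dots> \<le> card S * card \<M>"
  proof -
    have "2 * b * card (?d s) \<le> card \<M>" if "s \<in> S" for s
      using assms(5)[OF that] unfolding heavy_def \<M>_def by linarith
    thus ?thesis
      using sum_bounded_above[of S "\<lambda>s. 2 * b * card (?d s)" "card \<M>"] by simp
  qed
  also have "\<dots> \<le> b * card \<M>" using assms(4) by simp
  finally show ?thesis using assms(2) by (simp add: \<M>_def)
qed

text \<open>Greedy covering with density \<open>1 / (2 * b * m ^ k)\<close>: a heavy vertex sees
  \<open>k\<close> vertices of many sets \<open>M\<close>, and in each of these at least one of the
  at most \<open>m ^ k\<close> subsets of size \<open>k\<close> lies in its neighbourhood.\<close>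

lemma heavy_cover:
  assumes "finite (pverts G)" "b \<ge> 1" "X \<subseteq> pverts G" "card X < 2 ^ L"
    and "m = b * k + 1" "\<M> = indep_sets G X m" "\<M> \<noteq> {}"
  obtains \<I> where "\<I> \<subseteq> indep_sets G X k" "card \<I> \<le> 2 * b * m ^ k * L"
    "\<And>v. v \<in> X \<Longrightarrow> heavy G b \<M> k v \<Longrightarrow> \<exists>I\<in>\<I>. v \<in> common_nbrs G I"
proof -
  have "finite \<M>" unfolding assms(6) by (rule indep_sets_finite[OF assms(1)])
  have "k \<le> m" using assms(2,5) by (cases b) auto
  have M: "finite M" "card M = m" "M \<subseteq> X" "independent_set G M" if "M \<in> \<M>" for M
    using that independent_set_finite[OF assms(1)] by (auto simp: assms(6) indep_sets_def)
  \<comment> \<open>Pairs are used instead of the sets \<open>I\<close> alone: each \<open>M\<close>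
    then contributes exactly \<open>m choose k\<close> elements, so a fraction of \<M> translates
    into a fraction of \<open>P\<close>.\<close>
  define P where "P = (SIGMA M:\<M>. {I. I \<subseteq> M \<and> card I = k})"
  define R where "R = (\<lambda>(M :: 'a set, I) v. I \<subseteq> parcs G `` {v})"
  define W where "W = {v\<in>X. heavy G b \<M> k v}"
  have "finite P" unfolding P_def using \<open>finite \<M>\<close> M(1) by (intro finite_SigmaI) auto
  have "card P = (\<Sum>M\<in>\<M>. card {I. I \<subseteq> M \<and> card I = k})"
    unfolding P_def using \<open>finite \<M>\<close> M(1) by (intro card_SigmaI) auto
  also have "\<dots> = (\<Sum>M\<in>\<M>. m choose k)"
    using n_subsets[OF M(1)] M(2) by simp
  finally have card_P: "card P = card \<M> * (m choose k)" by simp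
  have "P \<noteq> {}"
  proof
    assume "P = {}"
    hence "card \<M> * (m choose k) = 0" using card_P by simp
    thus False using assms(7) \<open>finite \<M>\<close> \<open>k \<le> m\<close> by simp
  qed
  have dense: "card P \<le> 2 * b * m ^ k * card {p\<in>P. R p v}" if "v \<in> W" for v
  proof -
    let ?D = "{M\<in>\<M>. k \<le> card (M \<inter> parcs G `` {v})}"
    have "?D \<subseteq> fst ` {p\<in>P. R p v}"
    proof
      fix N assume N: "N \<in> ?D"
      hence "k \<le> card (N \<inter> parcs G `` {v})" by simp
      then obtain I where "I \<subseteq> N \<inter> parcs G `` {v}" "card I = k"
        using obtain_subset_with_card_n by metis
      hence "(N, I) \<in> {p\<in>P. R p v}" using N by (auto simp: P_def R_def)
      thus "N \<in> fst ` {p\<in>P. R p v}" by force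
    qed
    hence "card ?D \<le> card {p\<in>P. R p v}"
      using \<open>finite P\<close> by (intro surj_card_le) auto
    have "card P \<le> 2 * b * card ?D * (m choose k)"
      using that unfolding card_P W_def heavy_def by simp
    also have "\<dots> \<le> 2 * b * card {p\<in>P. R p v} * m ^ k"
      using \<open>card ?D \<le> _\<close> binomial_le_pow[OF \<open>k \<le> m\<close>] by (intro mult_le_mono) auto
    finally show ?thesis by (simp add: algebra_simps)
  qed
  have "finite X" using assms(1,3) finite_subset by blast
  hence W: "finite W" "card W < 2 ^ L"
    using card_mono[of X W] assms(4) by (auto simp: W_def)
  have q: "2 * b * m ^ k \<ge> 1" using assms(2,5) by simp
  have "\<exists>Q\<subseteq>P. card Q \<le> 2 * b * m ^ k * L \<and> (\<forall>v\<in>W. \<exists>p\<in>Q. R p v)"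
    using W \<open>finite P\<close> \<open>P \<noteq> {}\<close> q dense by (intro log_cover) auto
  then obtain Q where Q: "Q \<subseteq> P" "card Q \<le> 2 * b * m ^ k * L" "\<And>v. v \<in> W \<Longrightarrow> \<exists>p\<in>Q. R p v"
    by auto
  show thesis
  proof (rule that[of "snd ` Q"])
    show "snd ` Q \<subseteq> indep_sets G X k"
    proof
      fix I assume "I \<in> snd ` Q"
      then obtain M where "M \<in> \<M>" "I \<subseteq> M" "card I = k" using Q(1) by (auto simp: P_def)
      thus "I \<in> indep_sets G X k"
        using M(3,4)[of M] independent_set_subset[of G M I] by (auto simp: indep_sets_def)
    qed
    show "card (snd ` Q) \<le> 2 * b * m ^ k * L"
      using order_trans[OF card_image_le[OF finite_subset[OF Q(1) \<open>finite P\<close>]] Q(2)] .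
    fix v assume "v \<in> X" "heavy G b \<M> k v"
    then obtain p where "p \<in> Q" "R p v" using Q(3)[of v] by (auto simp: W_def)
    thus "\<exists>I\<in>snd ` Q. v \<in> common_nbrs G I"
      using \<open>v \<in> X\<close> assms(3) by (auto simp: R_def common_nbrs_def intro!: bexI[of _ p])
  qed
qed

text \<open>\<open>D\<close> bounds the number of halvings still possible. One round adds
  \<open>t * a\<close> to the independence number, for the part complete to one of \<open>t\<close>
  independent sets, and \<open>t * e + b * L\<close> to the exponent of the count, where
  \<open>b * L\<close> pays for guessing a dominating set. The last \<open>m\<close> pays for the
  end of the recursion.\<close>

lemma coverable_halving:
  assumes "pair_graph G" "b \<ge> 1" "card (pverts G) < 2 ^ L" "m = b * k + 1" "t = 2 * b * m ^ k * L"
    and IH: "\<And>X. X \<subseteq> pverts G \<Longrightarrow> \<not> multipartite G X j k \<Longrightarrow> coverable G b X a (2 ^ e)"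
    and "X \<subseteq> pverts G" "\<not> multipartite G X (Suc j) k" "card (indep_sets G X m) < 2 ^ D"
  shows "coverable G b X (D * (t * a) + m) (2 ^ (D * (t * e + b * L)))"
proof -
  interpret pair_graph G by fact
  note fin = pair_finite_verts
  have sym: "sym (parcs G)" using pair_sym_arcs by (simp add: symmetric_def)
  \<comment> \<open>Without independent \<open>m\<close>-sets, \<open>X\<close> serves as its own
    container. \<open>D\<close> is arbitrary here because the recursion may stop with halvings to
    spare.\<close>
  have terminal: "coverable G b X (D * (t * a) + m) (2 ^ (D * (t * e + b * L)))"
    if "indep_sets G X m = {}" for X D
  proof (rule coverable_trivial)
    have "indep_number G X \<le> m"
    proof (subst indep_number_le_iff[OF fin], intro allI impI, rule ccontr)
      fix S assume S: "S \<subseteq> X" "independent_set G S" "\<not> card S \<le> m"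
      then obtain T where "T \<subseteq> S" "card T = m"
        by (meson nat_le_linear obtain_subset_with_card_n)
      hence "T \<in> indep_sets G X m"
        using S independent_set_subset by (auto simp: indep_sets_def)
      thus False using that by simp
    qed
    thus "indep_number G X \<le> D * (t * a) + m" by simp
  qed simp
  show ?thesis
    using assms(7-9)
  proof (induction D arbitrary: X)
    case 0
    hence "indep_sets G X m = {}" using indep_sets_finite[OF fin] by simp
    thus ?case by (rule terminal)
  next
    case (Suc D)
    show ?case
    proof (cases "indep_sets G X m = {}")
      case True
      thus ?thesis by (rule terminal)
    next
      case False
      have "card X < 2 ^ L"
        using card_mono[OF fin Suc.prems(1)] assms(3) by simp
      then obtain \<I> where \<I>: "\<I> \<subseteq> indep_sets G X k" "card \<I> \<le> t"
        "\<And>v. v \<in> X \<Longrightarrow> heavy G b (indep_sets G X m) k v \<Longrightarrow> \<exists>I\<in>\<I>. v \<in> common_nbrs G I"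
        using heavy_cover[OF fin assms(2) Suc.prems(1) _ assms(4) refl False] assms(5) by metis
      have "finite \<I>" using \<I>(1) indep_sets_finite[OF fin] finite_subset by blast
      \<comment> \<open>\<open>Y\<close> contains all heavy vertices of \<open>X\<close>, and each
        piece of it excludes one part fewer.\<close>
      define Y where "Y = (\<Union>I\<in>\<I>. X \<inter> common_nbrs G I)"
      have "coverable G b Y (card \<I> * a) ((2 ^ e) ^ card \<I>)"
        unfolding Y_def
      proof (intro coverable_UN[OF fin \<open>finite \<I>\<close>] IH)
        fix I assume "I \<in> \<I>"
        thus "\<not> multipartite G (X \<inter> common_nbrs G I) j k"
          using multipartite_Suc[OF sym] \<I>(1) Suc.prems(2) by blast
      qed (use Suc.prems(1) in auto)
      hence Y: "coverable G b Y (t * a) (2 ^ (t * e))"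
        by (rule coverable_mono)
          (use \<I>(2) in \<open>simp_all add: mult_le_mono power_mult[symmetric] mult.commute[of e]\<close>)
      let ?c = "2 ^ (D * (t * e + b * L)) :: nat"
      define \<S> where "\<S> = {S. S \<subseteq> X - Y \<and> card S \<le> b}"
      have "finite X" using fin Suc.prems(1) finite_subset by blast
      have "card \<S> \<le> (card (X - Y) + 1) ^ b" "finite \<S>"
        unfolding \<S>_def using card_subsets_le[of "X - Y" b] \<open>finite X\<close> by auto
      \<comment> \<open>The strict bound on \<open>card X\<close> absorbs the added 1.\<close>
      moreover have "card (X - Y) + 1 \<le> 2 ^ L"
        using card_mono[OF \<open>finite X\<close>, of "X - Y"] \<open>card X < 2 ^ L\<close> by simp
      ultimately have \<S>: "card \<S> \<le> 2 ^ (b * L)" "finite \<S>"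
        using power_mono[of "card (X - Y) + 1" "2 ^ L" b]
        by (auto simp: power_mult[symmetric] mult.commute[of L])
      have "coverable G b (X - Y) (D * (t * a) + m) (card \<S> * ?c)"
      proof (rule coverable_branch[where Y = "\<lambda>S. (X - Y) \<inter> (S \<union> parcs G `` S)"])
        fix S assume S: "S \<in> \<S>"
        \<comment> \<open>Heaviness is measured against the independent \<open>m\<close>-sets of
          \<open>X\<close>, so the halving is carried out inside \<open>X\<close>, and the cover is
          restricted to \<open>X - Y\<close> afterwards.\<close>
        let ?Z = "X \<inter> (S \<union> parcs G `` S)"
        \<comment> \<open>\<open>S\<close> avoids \<open>Y\<close>, hence all heavy
          vertices.\<close>
        have "\<not> heavy G b (indep_sets G X (b * k + 1)) k s" if "s \<in> S" for s
          using \<I>(3)[of s] S that unfolding \<S>_def Y_def assms(4) by blast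
        hence "2 * card (indep_sets G ?Z (b * k + 1)) \<le> card (indep_sets G X (b * k + 1))"
          using S Suc.prems(1) by (intro light_neighbourhood_halves[OF fin assms(2)]) (auto simp: \<S>_def)
        hence "card (indep_sets G ?Z m) < 2 ^ D" using Suc.prems(3) by (simp add: assms(4))
        moreover have "\<not> multipartite G ?Z (Suc j) k"
          using Suc.prems(2) unfolding multipartite_def by (meson le_inf_iff)
        ultimately have "coverable G b ?Z (D * (t * a) + m) ?c"
          using Suc.prems(1) by (intro Suc.IH) auto
        thus "coverable G b ((X - Y) \<inter> (S \<union> parcs G `` S)) (D * (t * a) + m) ?c"
          by (rule coverable_subset[OF fin]) auto
      next
        fix H assume H: "H \<subseteq> X - Y" "indep_number G H \<le> b"
        obtain S where S: "S \<subseteq> H" "independent_set G S" "H \<subseteq> S \<union> parcs G `` S"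
          using dominating_independent_subset[OF assms(1), of H] H(1) Suc.prems(1) by blast
        have "card S \<le> b" using H(2) S(1,2) by (simp add: indep_number_le_iff[OF fin])
        hence "S \<in> \<S>" using S(1) H(1) by (auto simp: \<S>_def)
        thus "\<exists>S\<in>\<S>. H \<subseteq> (X - Y) \<inter> (S \<union> parcs G `` S)" using S(3) H(1) by blast
      qed (use \<S> in auto)
      from coverable_Un[OF fin Y this]
      have "coverable G b (Y \<union> (X - Y)) (t * a + (D * (t * a) + m)) (2 ^ (t * e) * (card \<S> * ?c))" .
      moreover have "Y \<union> (X - Y) = X" by (auto simp: Y_def)
      moreover have "2 ^ (t * e) * (card \<S> * ?c) \<le> 2 ^ (t * e) * (2 ^ (b * L) * ?c)"
        using \<S>(1) by simp
      hence "2 ^ (t * e) * (card \<S> * ?c) \<le> 2 ^ (Suc D * (t * e + b * L))"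
        by (simp add: power_add[symmetric] algebra_simps)
      ultimately show ?thesis
        by (auto elim!: coverable_mono)
    qed
  qed
qed

section \<open>Bounds from the induction on the number of parts\<close>

text \<open>This function and the next unroll \<open>coverable_halving\<close> with
  \<open>D = m * L\<close>, for the independence number and for the binary logarithm of the count.
  For fixed \<open>k\<close> and \<open>j\<close> both are polynomials in \<open>b\<close> and
  \<open>L\<close>.\<close>

fun container_bound :: "nat \<Rightarrow> nat \<Rightarrow> nat \<Rightarrow> nat \<Rightarrow> nat" where
  "container_bound k b L 0 = 0"
| "container_bound k b L (Suc j) =
     (let m = b * k + 1; t = 2 * b * m ^ k * L in m * L * (t * container_bound k b L j) + m)"

fun log_count_bound :: "nat \<Rightarrow> nat \<Rightarrow> nat \<Rightarrow> nat \<Rightarrow> nat" where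
  "log_count_bound k b L 0 = 0"
| "log_count_bound k b L (Suc j) =
     (let m = b * k + 1; t = 2 * b * m ^ k * L in m * L * (t * log_count_bound k b L j + b * L))"

lemma multipartite_free_coverable:
  assumes "pair_graph G" "b \<ge> 1" "card (pverts G) < 2 ^ L"
    and "X \<subseteq> pverts G" "\<not> multipartite G X j k"
  shows "coverable G b X (container_bound k b L j) (2 ^ log_count_bound k b L j)"
  using assms(4,5)
proof (induction j arbitrary: X)
  case 0
  \<comment> \<open>A multipartite subgraph without parts always exists, so the assumption is
    contradictory.\<close>
  thus ?case by (simp add: multipartite_def)
next
  case (Suc j)
  interpret pair_graph G by fact
  note fin = pair_finite_verts
  define m where "m = b * k + 1"
  have "indep_sets G X m \<subseteq> {S. S \<subseteq> pverts G \<and> card S = m}"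
    by (auto simp: indep_sets_def independent_set_def)
  hence "card (indep_sets G X m) \<le> card (pverts G) choose m"
    using n_subsets[OF fin] card_mono[of "{S. S \<subseteq> pverts G \<and> card S = m}"] fin by auto
  also have "\<dots> \<le> card (pverts G) ^ m"
    by (cases "m \<le> card (pverts G)") (simp_all add: binomial_le_pow binomial_eq_0)
  \<comment> \<open>This yields the initial number \<open>m * L\<close> of halvings; strictness
    survives because \<open>m\<close> is positive.\<close>
  also have "\<dots> < (2 ^ L) ^ m"
    using assms(3) by (intro power_strict_mono) (auto simp: m_def)
  finally have "card (indep_sets G X m) < 2 ^ (m * L)"
    by (simp add: power_mult[symmetric] mult.commute)
  from coverable_halving[OF assms(1-3) m_def refl Suc.IH Suc.prems this]
  show ?case by (simp add: m_def Let_def)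
qed

subsection \<open>Growth rates\<close>

text \<open>The growth condition of \<open>poly_logarithmic\<close> without positivity, so that the
  bounds above, which are 0 for \<open>j = 0\<close>, fit in at every stage of their
  recursion.\<close>

definition polylog_bounded :: "(nat \<Rightarrow> nat) \<Rightarrow> bool" where
  "polylog_bounded g \<longleftrightarrow>
     (\<exists>c d :: nat. c \<ge> 1 \<and> d \<ge> 1 \<and> (\<forall>n\<ge>3. real (g n) \<le> real c * log 2 (real n) ^ d))"

lemma log_ge_1: "(n :: nat) \<ge> 3 \<Longrightarrow> 1 \<le> log 2 (real n)"
  by simp

lemma polylog_bounded_const: "polylog_bounded (\<lambda>_. K)"
  unfolding polylog_bounded_def
proof (rule exI[of _ "K + 1"], rule exI[of _ 1], intro conjI allI impI)
  fix n :: nat assume "n \<ge> 3"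
  hence "real K * 1 \<le> real (K + 1) * log 2 (real n)"
    using log_ge_1 by (intro mult_mono) auto
  thus "real K \<le> real (K + 1) * log 2 (real n) ^ 1" by simp
qed simp_all

lemma polylog_bounded_mult:
  assumes "polylog_bounded f" "polylog_bounded g"
  shows "polylog_bounded (\<lambda>n. f n * g n)"
proof -
  obtain c d c' d' :: nat where cd: "c \<ge> 1" "d \<ge> 1" "c' \<ge> 1" "d' \<ge> 1"
    "\<And>n. n \<ge> 3 \<Longrightarrow> real (f n) \<le> real c * log 2 (real n) ^ d"
    "\<And>n. n \<ge> 3 \<Longrightarrow> real (g n) \<le> real c' * log 2 (real n) ^ d'"
    using assms unfolding polylog_bounded_def by metis
  show ?thesis
    unfolding polylog_bounded_def
  proof (rule exI[of _ "c * c'"], rule exI[of _ "d + d'"], intro conjI allI impI)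
    fix n :: nat assume n: "n \<ge> 3"
    have "real (f n) * real (g n) \<le> (real c * log 2 (real n) ^ d) * (real c' * log 2 (real n) ^ d')"
      using cd(5,6)[OF n] by (intro mult_mono) (auto intro: order_trans[OF _ cd(5)[OF n]])
    thus "real (f n * g n) \<le> real (c * c') * log 2 (real n) ^ (d + d')"
      by (simp add: power_add algebra_simps)
  qed (use cd(1-4) in auto)
qed

lemma polylog_bounded_add:
  assumes "polylog_bounded f" "polylog_bounded g"
  shows "polylog_bounded (\<lambda>n. f n + g n)"
proof -
  obtain c d c' d' :: nat where cd: "c \<ge> 1" "d \<ge> 1" "c' \<ge> 1" "d' \<ge> 1"
    "\<And>n. n \<ge> 3 \<Longrightarrow> real (f n) \<le> real c * log 2 (real n) ^ d"
    "\<And>n. n \<ge> 3 \<Longrightarrow> real (g n) \<le> real c' * log 2 (real n) ^ d'"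
    using assms unfolding polylog_bounded_def by metis
  show ?thesis
    unfolding polylog_bounded_def
  proof (rule exI[of _ "c + c'"], rule exI[of _ "d + d'"], intro conjI allI impI)
    fix n :: nat assume n: "n \<ge> 3"
    have "log 2 (real n) ^ d \<le> log 2 (real n) ^ (d + d')"
      "log 2 (real n) ^ d' \<le> log 2 (real n) ^ (d + d')"
      using log_ge_1[OF n] by (auto intro!: power_increasing)
    hence "real c * log 2 (real n) ^ d + real c' * log 2 (real n) ^ d'
        \<le> real c * log 2 (real n) ^ (d + d') + real c' * log 2 (real n) ^ (d + d')"
      by (intro add_mono mult_left_mono) auto
    thus "real (f n + g n) \<le> real (c + c') * log 2 (real n) ^ (d + d')"
      using cd(5,6)[OF n] by (simp add: algebra_simps)
  qed (use cd(1-4) in auto)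
qed

lemma polylog_bounded_power: "polylog_bounded f \<Longrightarrow> polylog_bounded (\<lambda>n. f n ^ k)"
  by (induction k) (auto intro: polylog_bounded_const polylog_bounded_mult)

lemmas polylog_bounded_intros =
  polylog_bounded_const polylog_bounded_mult polylog_bounded_add polylog_bounded_power

text \<open>The number of binary digits of a positive \<open>n\<close>; it instantiates
  \<open>L\<close>.\<close>

definition bit_length :: "nat \<Rightarrow> nat" where
  "bit_length n = nat \<lfloor>log 2 (real n)\<rfloor> + 1"

lemma less_two_power_bit_length:
  assumes "n \<ge> 1"
  shows "n < 2 ^ bit_length n"
proof -
  have "log 2 (real n) < real (bit_length n)"
    unfolding bit_length_def by linarith
  hence "real n < 2 powr real (bit_length n)"
    using assms by (simp add: log_less_iff)
  thus ?thesis by (simp add: powr_realpow)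
qed

lemma polylog_bounded_bit_length: "polylog_bounded bit_length"
  unfolding polylog_bounded_def
proof (rule exI[of _ 2], rule exI[of _ 1], intro conjI allI impI)
  fix n :: nat assume "n \<ge> 3"
  hence "1 \<le> log 2 (real n)" by (rule log_ge_1)
  hence "real (bit_length n) \<le> 2 * log 2 (real n)"
    unfolding bit_length_def by linarith
  thus "real (bit_length n) \<le> real 2 * log 2 (real n) ^ 1" by simp
qed simp_all

lemma polylog_bounded_container_bound:
  assumes "polylog_bounded b" "polylog_bounded L"
  shows "polylog_bounded (\<lambda>n. container_bound k (b n) (L n) j)"
  by (induction j; simp only: container_bound.simps Let_def) (intro polylog_bounded_intros assms; assumption?)+

lemma polylog_bounded_log_count_bound:
  assumes "polylog_bounded b" "polylog_bounded L"
  shows "polylog_bounded (\<lambda>n. log_count_bound k (b n) (L n) j)"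
  by (induction j; simp only: log_count_bound.simps Let_def) (intro polylog_bounded_intros assms; assumption?)+

text \<open>With \<open>l = log 2 n\<close>, the exponent \<open>c * l ^ d\<close> is at most a
  constant plus \<open>l ^ (d + 1)\<close>, and \<open>2 powr (l ^ (d + 1))\<close> equals
  \<open>n powr (l ^ d)\<close>.\<close>

lemma quasi_polynomial_two_power:
  assumes "polylog_bounded e"
  shows "quasi_polynomial (\<lambda>n. 2 ^ e n)"
proof -
  obtain c d :: nat where cd: "c \<ge> 1" "d \<ge> 1"
    "\<And>n. n \<ge> 3 \<Longrightarrow> real (e n) \<le> real c * log 2 (real n) ^ d"
    using assms unfolding polylog_bounded_def by metis
  \<comment> \<open>The first summand is the constant from the exponent; the others serve
    \<open>n = 1\<close> and \<open>n = 2\<close>, where the bound on \<open>e\<close> says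
    nothing.\<close>
  define K :: nat where "K = 2 ^ (c ^ Suc d) + 2 ^ e 1 + 2 ^ e 2"
  have "real (2 ^ e n) \<le> real K * real n powr (log 2 (real n) ^ d)" if "n \<ge> 1" for n
  proof (cases "n \<ge> 3")
    case True
    define l where "l = log 2 (real n)"
    have l: "l \<ge> 1" unfolding l_def by (rule log_ge_1[OF True])
    \<comment> \<open>The larger of \<open>c\<close> and \<open>l\<close> replaces the other
      one.\<close>
    have "real c * l ^ d \<le> real c ^ Suc d + l ^ Suc d"
    proof (cases "l \<le> real c")
      case True
      hence "real c * l ^ d \<le> real c * real c ^ d"
        using l by (intro mult_left_mono power_mono) auto
      thus ?thesis using l by (simp add: add_increasing2)
    next
      case False
      hence "real c * l ^ d \<le> l * l ^ d" using l by (intro mult_right_mono) auto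
      thus ?thesis by (simp add: add_increasing)
    qed
    hence "real (e n) \<le> real (c ^ Suc d) + l ^ Suc d"
      using cd(3)[OF True] by (simp add: l_def)
    hence "2 powr real (e n) \<le> 2 powr (real (c ^ Suc d)) * 2 powr (l ^ Suc d)"
      unfolding powr_add[symmetric] by (intro powr_mono) auto
    also have "2 powr (l ^ Suc d) = (2 powr l) powr (l ^ d)"
      by (simp add: powr_powr)
    also have "2 powr l = real n" using True by (simp add: l_def)
    also have "2 powr real (c ^ Suc d) \<le> real K"
      unfolding K_def by (simp only: powr_realpow) simp
    finally have "2 powr real (e n) \<le> real K * real n powr (l ^ d)"
      by (simp add: mult_right_mono)
    thus ?thesis by (simp add: powr_realpow l_def)
  next
    case False
    hence "n = 1 \<or> n = 2" using that by auto
    hence "(2 ^ e n :: nat) \<le> K" unfolding K_def by auto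
    hence "real (2 ^ e n) * 1 \<le> real K * real n powr (log 2 (real n) ^ d)"
      using that by (intro mult_mono ge_one_powr_ge_zero of_nat_mono) auto
    thus ?thesis by simp
  qed
  moreover have "K \<ge> 1" by (simp add: K_def Suc_le_eq)
  ultimately show ?thesis unfolding quasi_polynomial_def using cd(2) by auto
qed

text \<open>Intended for \<open>k = 2 ^ s\<close>: a power of \<open>log 2 (k ^ 2) = 2 * s\<close>
  is eventually smaller than \<open>k\<close>.\<close>

lemma eventually_power_less_exp:
  "eventually (\<lambda>s :: nat. K * (2 * real s) ^ p < 2 ^ s) sequentially"
proof -
  have "filterlim (\<lambda>s. ln 2 * real s) at_top sequentially"
    by (intro filterlim_tendsto_pos_mult_at_top[OF tendsto_const] filterlim_real_sequentially) simp
  hence "((\<lambda>s. (ln 2 * real s) ^ p / exp (ln 2 * real s)) \<longlongrightarrow> 0) sequentially"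
    by (rule filterlim_compose[OF tendsto_power_div_exp_0])
  hence "((\<lambda>s. K * (2 / ln 2) ^ p * ((ln 2 * real s) ^ p / exp (ln 2 * real s))) \<longlongrightarrow> 0) sequentially"
    by (rule tendsto_mult_right_zero)
  hence "eventually (\<lambda>s. K * (2 / ln 2) ^ p * ((ln 2 * real s) ^ p / exp (ln 2 * real s)) < 1) sequentially"
    by (rule order_tendstoD) simp
  thus ?thesis
  proof eventually_elim
    case (elim s)
    have "exp (ln 2 * real s) = (2 :: real) ^ s"
      using exp_of_nat2_mult[of "ln 2 :: real" s] by simp
    moreover have "(2 / ln 2) ^ p * (ln 2 * real s) ^ p = (2 * real s) ^ p"
      unfolding power_mult_distrib[symmetric] by simp
    moreover have "K * (2 / ln 2) ^ p * ((ln 2 * real s) ^ p / exp (ln 2 * real s))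
        = K * ((2 / ln 2) ^ p * (ln 2 * real s) ^ p) / exp (ln 2 * real s)"
      by (simp only: times_divide_eq_right mult.assoc)
    ultimately have "K * (2 * real s) ^ p / 2 ^ s < 1" using elim by (simp only:)
    thus ?case by (simp only: pos_divide_less_eq zero_less_power zero_less_numeral mult_1)
  qed
qed

subsection \<open>Complete multipartite graphs in a hereditary class\<close>

text \<open>An isomorphism comes with separate maps on vertices and arcs. Since tails and heads are
  \<open>fst\<close> and \<open>snd\<close> on both sides, the vertex map determines the arc
  map.\<close>

lemma digraph_iso_with_proj_iff:
  "digraph_iso (with_proj G) (with_proj H) \<longleftrightarrow>
     pair_wf_digraph G \<and>
     (\<exists>\<phi>. inj_on \<phi> (pverts G) \<and> pverts H = \<phi> ` pverts G \<and> parcs H = map_prod \<phi> \<phi> ` parcs G)"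
  (is "_ \<longleftrightarrow> _ \<and> (\<exists>\<phi>. ?iso \<phi>)")
proof (intro iffI conjI; (elim conjE exE)?)
  have wf: "wf_digraph (with_proj G) \<longleftrightarrow> pair_wf_digraph G"
    by (auto simp: wf_digraph_def pair_wf_digraph_def)
  {
    assume "digraph_iso (with_proj G) (with_proj H)"
    then obtain f where f: "pre_digraph.digraph_isomorphism (with_proj G) f"
      "with_proj H = app_iso f (with_proj G)"
      unfolding digraph_iso_def by blast
    show "pair_wf_digraph G"
      using f(1) wf by (simp add: pre_digraph.digraph_isomorphism_def)
    have H: "pverts H = iso_verts f ` pverts G" "parcs H = iso_arcs f ` parcs G"
      "iso_tail f = fst" "iso_head f = snd"
      using f(2) by (auto simp: with_proj_def app_iso_def)
    have "iso_arcs f a = map_prod (iso_verts f) (iso_verts f) a" if "a \<in> parcs G" for a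
      using f(1) that H(3,4)
      by (intro prod_eqI) (auto simp: pre_digraph.digraph_isomorphism_def)
    hence "parcs H = map_prod (iso_verts f) (iso_verts f) ` parcs G"
      unfolding H(2) by (intro image_cong) auto
    thus "\<exists>\<phi>. ?iso \<phi>"
      using H(1) f(1) by (auto simp: pre_digraph.digraph_isomorphism_def)
  next
    fix \<phi> assume *: "pair_wf_digraph G" "inj_on \<phi> (pverts G)" "pverts H = \<phi> ` pverts G"
      "parcs H = map_prod \<phi> \<phi> ` parcs G"
    let ?f = "\<lparr>iso_verts = \<phi>, iso_arcs = map_prod \<phi> \<phi>, iso_head = snd, iso_tail = fst\<rparr>"
    have "parcs G \<subseteq> pverts G \<times> pverts G"
      using pair_wf_digraph.in_arcsD1[OF *(1)] pair_wf_digraph.in_arcsD2[OF *(1)] by auto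
    hence "inj_on (map_prod \<phi> \<phi>) (parcs G)"
      using map_prod_inj_on[OF *(2) *(2)] inj_on_subset by blast
    hence "pre_digraph.digraph_isomorphism (with_proj G) ?f"
      using * wf by (simp add: pre_digraph.digraph_isomorphism_def)
    moreover have "with_proj H = app_iso ?f (with_proj G)"
      using * by (simp add: with_proj_def app_iso_def)
    ultimately show "digraph_iso (with_proj G) (with_proj H)"
      unfolding digraph_iso_def by blast
  }
qed

abbreviation complete_multipartite :: "nat \<Rightarrow> (nat \<times> nat) pair_pre_digraph" where
  "complete_multipartite k \<equiv> complement_graph (disjoint_copies k (complete_graph k))"

lemma pverts_complete_multipartite: "pverts (complete_multipartite k) = {..<k} \<times> {..<k}"
  by (simp add: complement_graph_def disjoint_copies_def complete_graph_def)

lemma parcs_complete_multipartite: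
  "parcs (complete_multipartite k) = {((i, x), (j, y)). i < k \<and> x < k \<and> j < k \<and> y < k \<and> i \<noteq> j}"
  by (auto simp: complement_graph_def disjoint_copies_def complete_graph_def)

lemma hereditary_pair_graph: "hereditary C \<Longrightarrow> G \<in> C \<Longrightarrow> pair_graph G"
  unfolding hereditary_def graph_class_def by blast

text \<open>Enumerating the parts embeds the complete multipartite graph into \<open>G\<close>; the
  subgraph \<open>H\<close> induced on the image belongs to \<open>C\<close> by heredity.\<close>

lemma multipartite_imp_in_graph_class:
  assumes "hereditary C" "G \<in> C" "multipartite G (pverts G) k k"
  shows "in_graph_class (complete_multipartite k) C"
proof -
  interpret pair_graph G using assms(1,2) by (rule hereditary_pair_graph)
  obtain f :: "nat \<Rightarrow> nat set" where
    f: "\<And>i. i < k \<Longrightarrow> f i \<subseteq> pverts G" "\<And>i. i < k \<Longrightarrow> independent_set G (f i)"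
      "\<And>i. i < k \<Longrightarrow> card (f i) = k"
      "\<And>i j. i < k \<Longrightarrow> j < k \<Longrightarrow> i \<noteq> j \<Longrightarrow> f i \<times> f j \<subseteq> parcs G"
    using assms(3) unfolding multipartite_def by metis
  have "\<exists>h. bij_betw h {..<k} (f i)" if "i < k" for i
    using ex_bij_betw_nat_finite[OF finite_subset[OF f(1)[OF that] pair_finite_verts]] f(3)[OF that]
    by (simp add: atLeast0LessThan)
  then obtain h where h: "\<And>i. i < k \<Longrightarrow> bij_betw (h i) {..<k} (f i)" by metis
  hence h_in: "h i x \<in> f i" if "i < k" "x < k" for i x
    using bij_betwE that by blast
  define \<phi> where "\<phi> = (\<lambda>(i, x). h i x)"
  define H where "H = \<lparr>pverts = \<phi> ` ({..<k} \<times> {..<k}),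
      parcs = {e \<in> parcs G. fst e \<in> \<phi> ` ({..<k} \<times> {..<k}) \<and> snd e \<in> \<phi> ` ({..<k} \<times> {..<k})}\<rparr>"
  have arc: "(h i x, h j y) \<in> parcs G \<longleftrightarrow> i \<noteq> j" if "i < k" "x < k" "j < k" "y < k" for i x j y
    using f(2)[OF that(1)] f(4)[OF that(1,3)] h_in that unfolding independent_set_def by blast
  have "inj_on \<phi> ({..<k} \<times> {..<k})"
  proof (rule inj_onI, clarsimp simp: \<phi>_def)
    fix i x j y assume *: "i < k" "x < k" "j < k" "y < k" "h i x = h j y"
    \<comment> \<open>A vertex shared by two different parts would carry a loop.\<close>
    hence "i = j" using arc[of i x j y] arc[of i x i x] by metis
    thus "i = j \<and> x = y" using * h[of i] by (auto simp: bij_betw_def dest: inj_onD)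
  qed
  moreover have "parcs H = map_prod \<phi> \<phi> ` parcs (complete_multipartite k)"
  proof (intro equalityI subsetI)
    fix e assume "e \<in> parcs H"
    then obtain i x j y where "e = (h i x, h j y)" "i < k" "x < k" "j < k" "y < k" "e \<in> parcs G"
      unfolding H_def \<phi>_def by (cases e) auto
    hence "e = map_prod \<phi> \<phi> ((i, x), (j, y))"
      "((i, x), (j, y)) \<in> parcs (complete_multipartite k)"
      using arc by (auto simp: \<phi>_def parcs_complete_multipartite)
    thus "e \<in> map_prod \<phi> \<phi> ` parcs (complete_multipartite k)" by (rule image_eqI)
  next
    fix e assume "e \<in> map_prod \<phi> \<phi> ` parcs (complete_multipartite k)"
    then obtain i x j y where e: "e = (h i x, h j y)" "i < k" "x < k" "j < k" "y < k" "i \<noteq> j"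
      by (auto simp: \<phi>_def parcs_complete_multipartite)
    have "h i x \<in> \<phi> ` ({..<k} \<times> {..<k})" "h j y \<in> \<phi> ` ({..<k} \<times> {..<k})"
      using e by (force simp: \<phi>_def)+
    thus "e \<in> parcs H" using e arc by (simp add: H_def)
  qed
  moreover have "pair_wf_digraph (complete_multipartite k)"
    by unfold_locales (auto simp: parcs_complete_multipartite pverts_complete_multipartite)
  ultimately have iso: "digraph_iso (with_proj (complete_multipartite k)) (with_proj H)"
    unfolding digraph_iso_with_proj_iff
    by (auto simp: H_def pverts_complete_multipartite intro!: exI[of _ \<phi>])
  have "pverts H \<subseteq> pverts G"
    using f(1) h_in by (fastforce simp: H_def \<phi>_def)
  moreover have "wf_digraph (with_proj H)"
    by unfold_locales (auto simp: H_def)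
  moreover have "wf_digraph (with_proj G)" by unfold_locales
  ultimately have "induced_subgraph (with_proj H) (with_proj G)"
    by (simp add: induced_subgraph_def subgraph_def compatible_def H_def)
  hence "H \<in> C" using assms(1,2) unfolding hereditary_def by blast
  thus ?thesis using iso unfolding in_graph_class_def by blast
qed

section \<open>Containers and transversals\<close>

lemma container_family_if_coverable:
  "coverable G b (pverts G) a c \<Longrightarrow> \<exists>\<F>. container_family b a G \<F> \<and> card \<F> \<le> c"
  unfolding coverable_def container_family_def by (erule ex_forward) simp

lemma transversal_count:
  assumes "pair_graph G" "digraph_iso (with_proj (complete_multipartite k)) (with_proj G)"
    and "container_family b a G \<F>" "b \<ge> 1"
  shows "k ^ k \<le> card \<F> * a ^ k"
proof -
  interpret pair_graph G by fact
  note fin = pair_finite_verts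
  obtain \<phi> where \<phi>: "inj_on \<phi> ({..<k} \<times> {..<k})" "pverts G = \<phi> ` ({..<k} \<times> {..<k})"
    "parcs G = map_prod \<phi> \<phi> ` parcs (complete_multipartite k)"
    using assms(2) unfolding digraph_iso_with_proj_iff pverts_complete_multipartite by blast
  have arc: "(\<phi> (i, x), \<phi> (j, y)) \<in> parcs G \<longleftrightarrow> i \<noteq> j"
    if "i < k" "x < k" "j < k" "y < k" for i x j y
  proof
    assume "(\<phi> (i, x), \<phi> (j, y)) \<in> parcs G"
    then obtain i' x' j' y' where *: "i' < k" "x' < k" "j' < k" "y' < k" "i' \<noteq> j'"
      "\<phi> (i, x) = \<phi> (i', x')" "\<phi> (j, y) = \<phi> (j', y')"
      by (auto simp: \<phi>(3) parcs_complete_multipartite)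
    have "(i, x) = (i', x')" "(j, y) = (j', y')"
      using * that by (intro inj_onD[OF \<phi>(1)]; simp)+
    thus "i \<noteq> j" using *(5) by simp
  next
    assume "i \<noteq> j"
    hence "((i, x), (j, y)) \<in> parcs (complete_multipartite k)"
      using that by (simp add: parcs_complete_multipartite)
    from imageI[OF this, of "map_prod \<phi> \<phi>"] show "(\<phi> (i, x), \<phi> (j, y)) \<in> parcs G"
      unfolding \<phi>(3) by simp
  qed
  \<comment> \<open>Transversals are encoded as choice functions, extensional so that there are
    exactly \<open>k ^ k\<close> of them.\<close>
  define T where "T = {..<k} \<rightarrow>\<^sub>E {..<k}"
  define H where "H = (\<lambda>g. (\<lambda>i. \<phi> (i, g i)) ` {..<k})"
  have g: "g i < k" if "g \<in> T" "i < k" for g i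
    using that by (auto simp: T_def)
  have F: "\<And>F. F \<in> \<F> \<Longrightarrow> F \<subseteq> pverts G" "\<And>F. F \<in> \<F> \<Longrightarrow> indep_number G F \<le> a"
    "\<And>H. H \<subseteq> pverts G \<Longrightarrow> indep_number G H \<le> b \<Longrightarrow> \<exists>F\<in>\<F>. H \<subseteq> F"
    using assms(3) unfolding container_family_def by auto
  have "finite \<F>"
    using F(1) fin by (intro finite_subset[of \<F> "Pow (pverts G)"]) auto
  have "\<exists>F\<in>\<F>. H g \<subseteq> F" if "g \<in> T" for g
  proof (rule F(3))
    show "H g \<subseteq> pverts G" using g[OF that] by (auto simp: H_def \<phi>(2))
    have "card S \<le> 1" if S: "S \<subseteq> H g" "independent_set G S" for S
    proof -
      have "u = v" if uv: "u \<in> S" "v \<in> S" for u v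
      proof -
        obtain i j where ij: "u = \<phi> (i, g i)" "v = \<phi> (j, g j)" "i < k" "j < k"
          using subsetD[OF S(1) uv(1)] subsetD[OF S(1) uv(2)] by (auto simp: H_def)
        have "(u, v) \<notin> parcs G" using S(2) uv by (auto simp: independent_set_def)
        thus "u = v" using arc[of i "g i" j "g j"] g[OF \<open>g \<in> T\<close>] ij by auto
      qed
      thus ?thesis by (cases "S = {}") (auto simp: card_le_Suc0_iff_eq independent_set_finite[OF fin S(2)])
    qed
    hence "indep_number G (H g) \<le> 1" by (auto simp: indep_number_le_iff[OF fin] simp del: One_nat_def)
    thus "indep_number G (H g) \<le> b" using assms(4) by simp
  qed
  hence "T \<subseteq> (\<Union>F\<in>\<F>. {g\<in>T. H g \<subseteq> F})" by blast
  have "finite T" unfolding T_def by (intro finite_PiE) auto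
  have bound: "card {g\<in>T. H g \<subseteq> F} \<le> a ^ k" if "F \<in> \<F>" for F
  proof -
    \<comment> \<open>The trace of \<open>F\<close> on part \<open>i\<close> is independent, hence
      has at most \<open>a\<close> vertices. A transversal inside \<open>F\<close> picks one vertex
      from each trace.\<close>
    define P where "P = (\<lambda>i. {x. x < k \<and> \<phi> (i, x) \<in> F})"
    have P: "card (P i) \<le> a" if "i < k" for i
    proof -
      let ?S = "(\<lambda>x. \<phi> (i, x)) ` P i"
      have "independent_set G ?S"
        using arc[OF that _ that] F(1)[OF \<open>F \<in> \<F>\<close>] by (auto simp: independent_set_def P_def)
      moreover have "?S \<subseteq> F" by (auto simp: P_def)
      ultimately have "card ?S \<le> a"
        using F(2)[OF \<open>F \<in> \<F>\<close>] indep_number_le_iff[OF fin, of F a] by blast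
      moreover have "inj_on (\<lambda>x. \<phi> (i, x)) (P i)"
        using inj_onD[OF \<phi>(1)] that by (fastforce intro!: inj_onI simp: P_def)
      ultimately show ?thesis by (simp add: card_image)
    qed
    have "{g\<in>T. H g \<subseteq> F} \<subseteq> PiE {..<k} P"
      by (rule subsetI) (simp add: T_def H_def P_def PiE_iff image_subset_iff)
    hence "card {g\<in>T. H g \<subseteq> F} \<le> card (PiE {..<k} P)"
      by (intro card_mono finite_PiE) (auto simp: P_def)
    also have "\<dots> = (\<Prod>i<k. card (P i))" by (simp add: card_PiE)
    also have "\<dots> \<le> (\<Prod>i<k. a)"
      using P by (intro prod_mono) auto
    finally show ?thesis by simp
  qed
  have "k ^ k = card T" by (simp add: T_def card_PiE)
  also have "\<dots> \<le> card (\<Union>F\<in>\<F>. {g\<in>T. H g \<subseteq> F})"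
    using \<open>T \<subseteq> _\<close> \<open>finite \<F>\<close> \<open>finite T\<close> by (intro card_mono) auto
  also have "\<dots> \<le> (\<Sum>F\<in>\<F>. card {g\<in>T. H g \<subseteq> F})" by (rule card_UN_le[OF \<open>finite \<F>\<close>])
  also have "\<dots> \<le> card \<F> * a ^ k"
    using bound sum_bounded_above[of \<F> "\<lambda>F. card {g\<in>T. H g \<subseteq> F}" "a ^ k"] by simp
  finally show "k ^ k \<le> card \<F> * a ^ k" .
qed

text \<open>For \<open>k = 2 ^ s\<close> and \<open>n = k ^ 2\<close>, large \<open>s\<close> gives
  \<open>2 * a n \<le> k\<close> and \<open>f n < 2 ^ k\<close>. Then \<open>f n * a n ^ k\<close>
  is less than \<open>(2 * a n) ^ k\<close>, which is at most \<open>k ^ k\<close>.\<close>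

lemma transversals_outgrow_containers:
  assumes "poly_logarithmic a" "quasi_polynomial f"
  shows "\<exists>k\<ge>1. f (k ^ 2) * a (k ^ 2) ^ k < k ^ k"
proof -
  obtain c d :: nat where a: "\<And>n. n \<ge> 1 \<Longrightarrow> a n \<ge> 1"
    "\<And>n. n \<ge> 3 \<Longrightarrow> real (a n) \<le> real c * log 2 (real n) ^ d"
    using assms(1) unfolding poly_logarithmic_def by auto
  obtain c' d' :: nat where f: "c' \<ge> 1"
    "\<And>n. n \<ge> 1 \<Longrightarrow> real (f n) \<le> real c' * real n powr (log 2 (real n) ^ d')"
    using assms(2) unfolding quasi_polynomial_def by auto
  have "eventually (\<lambda>s. s \<ge> 1 \<and> 2 * real c * (2 * real s) ^ d < 2 ^ s \<and>
      (real c' + 1) * (2 * real s) ^ Suc d' < 2 ^ s) sequentially"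
    by (intro eventually_conj eventually_power_less_exp eventually_ge_at_top)
  then obtain s where s: "s \<ge> 1" "2 * real c * (2 * real s) ^ d < 2 ^ s"
    "(real c' + 1) * (2 * real s) ^ Suc d' < 2 ^ s"
    using eventually_happens' sequentially_bot by blast
  define k :: nat where "k = 2 ^ s"
  define n where "n = k ^ 2"
  have n: "real n = 2 powr (2 * real s)"
    unfolding n_def k_def by (simp add: powr_realpow[symmetric] powr_powr mult.commute)
  hence log_n: "log 2 (real n) = 2 * real s" by simp
  have "4 \<le> n" unfolding n_def k_def
    using s(1) power_increasing[of 2 "2 * s" "2 :: nat"] by (simp add: power_mult[symmetric] mult.commute)
  have "2 * real (a n) \<le> 2 * real c * (2 * real s) ^ d"
    using a(2)[of n] \<open>4 \<le> n\<close> log_n by simp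
  hence "real (2 * a n) \<le> real k" using s(2) by (simp add: k_def)
  hence "2 * a n \<le> k" by linarith
  have "real (f n) \<le> real c' * (2 powr (2 * real s)) powr ((2 * real s) ^ d')"
    using f(2)[of n] \<open>4 \<le> n\<close> log_n n by simp
  also have "\<dots> = real c' * 2 powr ((2 * real s) ^ Suc d')"
    by (simp add: powr_powr)
  \<comment> \<open>The estimate \<open>c' \<le> 2 ^ c'\<close> moves the constant factor into the
    exponent.\<close>
  also have "\<dots> \<le> 2 powr real c' * 2 powr ((2 * real s) ^ Suc d')"
    using of_nat_mono[OF less_imp_le[OF less_exp[of c']], where ?'a = real]
    by (intro mult_right_mono) (simp_all add: powr_realpow)
  also have "\<dots> = 2 powr (real c' + (2 * real s) ^ Suc d')"
    by (simp add: powr_add)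
  also have "\<dots> < 2 powr real k"
  proof (rule powr_less_mono)
    have "real c' * 1 \<le> real c' * (2 * real s) ^ Suc d'"
      using s(1) by (intro mult_left_mono one_le_power) auto
    thus "real c' + (2 * real s) ^ Suc d' < real k"
      using s(3) by (simp add: k_def algebra_simps)
  qed simp
  finally have "real (f n) < real (2 ^ k)" by (simp add: powr_realpow)
  hence "f n < 2 ^ k" by linarith
  hence "f n * a n ^ k < 2 ^ k * a n ^ k"
    using a(1)[of n] \<open>4 \<le> n\<close> by simp
  also have "\<dots> \<le> k ^ k"
    using power_mono[OF \<open>2 * a n \<le> k\<close>, of k] by (simp add: power_mult_distrib)
  finally show ?thesis unfolding n_def by (intro exI[of _ k]) (auto simp: k_def)
qed

section \<open>Assembling the two implications\<close>

theorem theorem1p3: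
  fixes C :: "nat pair_pre_digraph set" and b :: "nat \<Rightarrow> nat"
  assumes "hereditary C"
    and "poly_logarithmic b"
  shows "(\<exists>a f. poly_logarithmic a \<and> quasi_polynomial f \<and>
            (\<forall>n\<ge>1. \<forall>G\<in>C. card (pverts G) = n \<longrightarrow>
               (\<exists>\<F>. container_family (b n) (a n) G \<F> \<and> card \<F> \<le> f n)))
         \<longleftrightarrow>
         (\<exists>k\<ge>1. \<not> in_graph_class (complement_graph (disjoint_copies k (complete_graph k))) C)"
proof
  note graph = hereditary_pair_graph[OF assms(1)]
  have b: "b n \<ge> 1" if "n \<ge> 1" for n
    using assms(2) that by (auto simp: poly_logarithmic_def)
  {
    assume "\<exists>a f. poly_logarithmic a \<and> quasi_polynomial f \<and>
            (\<forall>n\<ge>1. \<forall>G\<in>C. card (pverts G) = n \<longrightarrow>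
               (\<exists>\<F>. container_family (b n) (a n) G \<F> \<and> card \<F> \<le> f n))"
    then obtain a f where af: "poly_logarithmic a" "quasi_polynomial f"
      "\<And>G. G \<in> C \<Longrightarrow> card (pverts G) \<ge> 1 \<Longrightarrow>
        \<exists>\<F>. container_family (b (card (pverts G))) (a (card (pverts G))) G \<F> \<and>
            card \<F> \<le> f (card (pverts G))"
      by blast
    obtain k where k: "k \<ge> 1" "f (k ^ 2) * a (k ^ 2) ^ k < k ^ k"
      using transversals_outgrow_containers[OF af(1,2)] by blast
    have "\<not> in_graph_class (complete_multipartite k) C"
    proof
      assume "in_graph_class (complete_multipartite k) C"
      then obtain G where G: "G \<in> C" "digraph_iso (with_proj (complete_multipartite k)) (with_proj G)"
        unfolding in_graph_class_def by blast
      note iso = G(2)[unfolded digraph_iso_with_proj_iff pverts_complete_multipartite]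
      have n: "card (pverts G) = k ^ 2"
        using iso by (auto simp: card_image power2_eq_square)
      hence n1: "card (pverts G) \<ge> 1" using k(1) by simp
      obtain \<F> where \<F>: "container_family (b (k ^ 2)) (a (k ^ 2)) G \<F>" "card \<F> \<le> f (k ^ 2)"
        using af(3)[OF G(1) n1] unfolding n by blast
      have "k ^ k \<le> card \<F> * a (k ^ 2) ^ k"
        using b[OF n1] n by (intro transversal_count[OF graph[OF G(1)] G(2) \<F>(1)]) simp
      also have "\<dots> \<le> f (k ^ 2) * a (k ^ 2) ^ k" using \<F>(2) by simp
      finally show False using k(2) by simp
    qed
    thus "\<exists>k\<ge>1. \<not> in_graph_class (complete_multipartite k) C" using k(1) by blast
  next
    assume "\<exists>k\<ge>1. \<not> in_graph_class (complete_multipartite k) C"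
    then obtain k where k: "k \<ge> 1" "\<not> in_graph_class (complete_multipartite k) C" by blast
    \<comment> \<open>The excluded graph has \<open>k\<close> parts of size \<open>k\<close>, so
      both parameters of the bounds are \<open>k\<close>.\<close>
    define a where "a = (\<lambda>n. container_bound k (b n) (bit_length n) k)"
    define e where "e = (\<lambda>n. log_count_bound k (b n) (bit_length n) k)"
    have polylog_b: "polylog_bounded b"
      using assms(2) by (simp add: poly_logarithmic_def polylog_bounded_def)
    \<comment> \<open>As \<open>k\<close> is positive, the recursion unfolds at least once and
      contributes the positive summand \<open>m\<close>.\<close>
    have "\<forall>n. a n \<ge> 1" using k(1) unfolding a_def by (cases k) (auto simp: Let_def)
    moreover have "polylog_bounded a"
      unfolding a_def by (intro polylog_bounded_container_bound polylog_b polylog_bounded_bit_length)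
    ultimately have "poly_logarithmic a"
      by (simp add: poly_logarithmic_def polylog_bounded_def)
    moreover have "quasi_polynomial (\<lambda>n. 2 ^ e n)"
      unfolding e_def
      by (intro quasi_polynomial_two_power polylog_bounded_log_count_bound polylog_b
          polylog_bounded_bit_length)
    moreover have "\<exists>\<F>. container_family (b n) (a n) G \<F> \<and> card \<F> \<le> 2 ^ e n"
      if "n \<ge> 1" "G \<in> C" "card (pverts G) = n" for n G
    proof -
      have "\<not> multipartite G (pverts G) k k"
        using multipartite_imp_in_graph_class[OF assms(1) that(2)] k(2) by blast
      hence "coverable G (b n) (pverts G) (a n) (2 ^ e n)"
        unfolding a_def e_def
        using less_two_power_bit_length[OF that(1)] that(3)
        by (intro multipartite_free_coverable graph[OF that(2)] b[OF that(1)]) auto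
      thus ?thesis by (rule container_family_if_coverable)
    qed
    ultimately show "\<exists>a f. poly_logarithmic a \<and> quasi_polynomial f \<and>
            (\<forall>n\<ge>1. \<forall>G\<in>C. card (pverts G) = n \<longrightarrow>
               (\<exists>\<F>. container_family (b n) (a n) G \<F> \<and> card \<F> \<le> f n))"
      by blast
  }
qed

end
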